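(* Let $K,L_1,L_2$ be finite commutative unital rings such that $\varTheta(K)\cong\varTheta(L_1)\times\varTheta(L_2)$ as graphs. Then $K=K_1\times K_2$ for some subrings $K_1,K_2\subseteq K$ with $\varTheta(K_1)\cong\varTheta(L_1)$ and $\varTheta(K_2)\cong\varTheta(L_2)$.
   Context: The zero ring counts as a unital ring. On a finite commutative unital ring $K$, elements $a,b$ are associated, $a\sim b$, if $a=bu$ for some invertible $u\in K$; $[a]$ is the class of $a$. The graph $\varTheta(K)$ has as vertices all associatedness classes of elements of $K$ (including $[0]$ and $[1]$), and vertices $[u]$, $[v]$ (not necessarily distinct) are adjacent if and only if $uv=0$; so loops are allowed. The product of graphs is the tensor product: $G\times H$ has vertex set $V(G)\times V(H)$ and $(g,h)$ is adjacent to $(g',h')$ if and only if $g$ is adjacent to $g'$ and $h$ is adjacent to $h'$. The equality $K=K_1\times K_2$ denotes an internal direct product decomposition of $K$ ($K_1,K_2$ are ideals of $K$ with $K_1\cap K_2=0$ and $K_1+K_2=K$); the subrings $K_1$, $K_2$ need not contain the identity of $K$, but each is a unital ring with its own identity element, and $\varTheta(K_i)$ is formed with respect to it. *)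

theory Defs
  imports "HOL-Algebra.Algebra"
begin

(* Undirected graphs without multiple edges in which loops are allowed.  Only the values of
   adj on pairs of vertices matter; symmetry of adj is not built into the type. *)
record 'v loop_graph =
  verts :: "'v set"
  adj :: "'v \<Rightarrow> 'v \<Rightarrow> bool"

definition graph_iso :: "'v loop_graph \<Rightarrow> 'w loop_graph \<Rightarrow> bool" where
  "graph_iso G H \<longleftrightarrow>
     (\<exists>f. bij_betw f (verts G) (verts H) \<and>
          (\<forall>x\<in>verts G. \<forall>y\<in>verts G. adj G x y \<longleftrightarrow> adj H (f x) (f y)))"

definition tensor_product :: "'v loop_graph \<Rightarrow> 'w loop_graph \<Rightarrow> ('v \<times> 'w) loop_graph" where
  "tensor_product G H =
     \<lparr> verts = verts G \<times> verts H,
       adj = (\<lambda>p q. adj G (fst p) (fst q) \<and> adj H (snd p) (snd q)) \<rparr>"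

(* Associatedness via a unit factor; the library's associated means mutual divisibility. *)
definition unit_associated :: "('a, 'm) ring_scheme \<Rightarrow> 'a \<Rightarrow> 'a \<Rightarrow> bool" where
  "unit_associated K a b \<longleftrightarrow> (\<exists>u\<in>Units K. a = b \<otimes>\<^bsub>K\<^esub> u)"

definition assoc_class :: "('a, 'm) ring_scheme \<Rightarrow> 'a \<Rightarrow> 'a set" where
  "assoc_class K a = {b \<in> carrier K. unit_associated K b a}"

definition Theta :: "('a, 'm) ring_scheme \<Rightarrow> 'a set loop_graph" where
  "Theta K =
     \<lparr> verts = assoc_class K ` carrier K,
       adj = (\<lambda>U V. \<exists>u\<in>carrier K. \<exists>v\<in>carrier K.
                U = assoc_class K u \<and> V = assoc_class K v \<and> u \<otimes>\<^bsub>K\<^esub> v = \<zero>\<^bsub>K\<^esub>) \<rparr>"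

definition internal_direct_product ::
    "('a, 'm) ring_scheme \<Rightarrow> 'a set \<Rightarrow> 'a set \<Rightarrow> bool" where
  "internal_direct_product K I J \<longleftrightarrow>
     ideal I K \<and> ideal J K \<and> I \<inter> J = {\<zero>\<^bsub>K\<^esub>} \<and> I <+>\<^bsub>K\<^esub> J = carrier K"

definition identity_of :: "('a, 'm) ring_scheme \<Rightarrow> 'a set \<Rightarrow> 'a \<Rightarrow> bool" where
  "identity_of K I e \<longleftrightarrow> e \<in> I \<and> (\<forall>x\<in>I. e \<otimes>\<^bsub>K\<^esub> x = x \<and> x \<otimes>\<^bsub>K\<^esub> e = x)"

(* The ideal I as a ring in its own right, with identity e, usually not that of K.
   Units, and hence Theta, of this ring are taken with respect to e. *)
definition ideal_as_ring ::
    "('a, 'm) ring_scheme \<Rightarrow> 'a set \<Rightarrow> 'a \<Rightarrow> ('a, 'm) ring_scheme" where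
  "ideal_as_ring K I e = K\<lparr>carrier := I, one := e\<rparr>"

lemma assoc_class_self:
  assumes "cring K" "a \<in> carrier K"
  shows "a \<in> assoc_class K a"
proof -
  interpret cring K by fact
  show ?thesis
    using assms(2) Units_one_closed r_one
    by (force simp: assoc_class_def unit_associated_def)
qed

lemma Theta_adj_iff:
  assumes "cring K" and u: "u \<in> carrier K" and v: "v \<in> carrier K"
  shows "adj (Theta K) (assoc_class K u) (assoc_class K v) \<longleftrightarrow> u \<otimes>\<^bsub>K\<^esub> v = \<zero>\<^bsub>K\<^esub>"
proof
  interpret cring K by fact
  assume "adj (Theta K) (assoc_class K u) (assoc_class K v)"
  then obtain u' v' where c: "u' \<in> carrier K" "v' \<in> carrier K"
      "assoc_class K u = assoc_class K u'" "assoc_class K v = assoc_class K v'"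
    and z: "u' \<otimes>\<^bsub>K\<^esub> v' = \<zero>\<^bsub>K\<^esub>"
    by (auto simp: Theta_def)
  have "u \<in> assoc_class K u'" "v \<in> assoc_class K v'"
    using assoc_class_self[OF assms(1)] u v c by auto
  then obtain s t where st: "s \<in> Units K" "t \<in> Units K"
      "u = u' \<otimes>\<^bsub>K\<^esub> s" "v = v' \<otimes>\<^bsub>K\<^esub> t"
    by (auto simp: assoc_class_def unit_associated_def)
  have cl: "s \<in> carrier K" "t \<in> carrier K" using st by auto
  have "u \<otimes>\<^bsub>K\<^esub> v = (u' \<otimes>\<^bsub>K\<^esub> v') \<otimes>\<^bsub>K\<^esub> (s \<otimes>\<^bsub>K\<^esub> t)"
    using c(1,2) cl st(3,4) by (simp add: m_ac)
  then show "u \<otimes>\<^bsub>K\<^esub> v = \<zero>\<^bsub>K\<^esub>" using z cl by simp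
next
  assume "u \<otimes>\<^bsub>K\<^esub> v = \<zero>\<^bsub>K\<^esub>"
  then show "adj (Theta K) (assoc_class K u) (assoc_class K v)"
    using u v by (auto simp: Theta_def)
qed

lemma ideal_as_ring_cring:
  assumes "cring K" "ideal I K" "identity_of K I e"
  shows "cring (ideal_as_ring K I e)"
proof -
  interpret cring K by fact
  interpret I: ideal I K by fact
  have sub: "\<And>x. x \<in> I \<Longrightarrow> x \<in> carrier K" using I.a_subset by auto
  have e: "e \<in> I" "\<And>x. x \<in> I \<Longrightarrow> e \<otimes>\<^bsub>K\<^esub> x = x" "\<And>x. x \<in> I \<Longrightarrow> x \<otimes>\<^bsub>K\<^esub> e = x"
    using assms(3) by (auto simp: identity_of_def)
  have inv: "\<exists>y\<in>I. x \<oplus>\<^bsub>K\<^esub> y = \<zero>\<^bsub>K\<^esub>" if "x \<in> I" for x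
    using that sub r_neg I.a_inv_closed by blast
  show ?thesis
  proof (rule cringI)
    show "abelian_group (ideal_as_ring K I e)"
      by (rule abelian_groupI; simp add: ideal_as_ring_def sub a_ac inv)
    show "comm_monoid (ideal_as_ring K I e)"
      by (rule comm_monoidI; simp add: ideal_as_ring_def sub m_ac e I.I_l_closed)
  qed (simp add: ideal_as_ring_def sub l_distr)
qed

lemma identity_of_unique:
  assumes "identity_of K I e" "identity_of K I f"
  shows "e = f"
proof -
  have "e \<otimes>\<^bsub>K\<^esub> f = f" "e \<otimes>\<^bsub>K\<^esub> f = e"
    using assms by (auto simp: identity_of_def)
  then show ?thesis by simp
qed

lemma internal_direct_product_identities:
  assumes "cring K" "internal_direct_product K I J"
  shows "\<exists>!e. identity_of K I e" "\<exists>!e. identity_of K J e"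
proof -
  interpret cring K by fact
  interpret I: ideal I K using assms by (simp add: internal_direct_product_def)
  interpret J: ideal J K using assms by (simp add: internal_direct_product_def)
  have int: "I \<inter> J = {\<zero>\<^bsub>K\<^esub>}" and sum: "I <+>\<^bsub>K\<^esub> J = carrier K"
    using assms(2) by (auto simp: internal_direct_product_def)
  have subI: "\<And>x. x \<in> I \<Longrightarrow> x \<in> carrier K" and subJ: "\<And>x. x \<in> J \<Longrightarrow> x \<in> carrier K"
    using I.a_subset J.a_subset by auto
  have "\<one>\<^bsub>K\<^esub> \<in> I <+>\<^bsub>K\<^esub> J" using sum by simp
  then obtain e f where ef: "e \<in> I" "f \<in> J" "\<one>\<^bsub>K\<^esub> = e \<oplus>\<^bsub>K\<^esub> f"
    by (auto simp: set_add_def')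
  have z: "x \<otimes>\<^bsub>K\<^esub> y = \<zero>\<^bsub>K\<^esub>" if "x \<in> I" "y \<in> J" for x y
  proof -
    have "x \<otimes>\<^bsub>K\<^esub> y \<in> I" "x \<otimes>\<^bsub>K\<^esub> y \<in> J"
      using that by (simp_all add: I.I_r_closed J.I_l_closed subI subJ)
    then show ?thesis using int by blast
  qed
  have comm: "x \<otimes>\<^bsub>K\<^esub> y = y \<otimes>\<^bsub>K\<^esub> x" if "x \<in> carrier K" "y \<in> carrier K" for x y
    using that by (rule m_comm)
  have e: "e \<otimes>\<^bsub>K\<^esub> x = x" if "x \<in> I" for x
  proof -
    have "f \<otimes>\<^bsub>K\<^esub> x = \<zero>\<^bsub>K\<^esub>" using z[OF that ef(2)] that ef(2) by (simp add: subI subJ m_comm)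
    then have "(e \<oplus>\<^bsub>K\<^esub> f) \<otimes>\<^bsub>K\<^esub> x = e \<otimes>\<^bsub>K\<^esub> x" using that ef(1,2) by (simp add: l_distr subI subJ)
    then show ?thesis using that by (simp add: subI flip: ef(3))
  qed
  have f: "f \<otimes>\<^bsub>K\<^esub> x = x" if "x \<in> J" for x
  proof -
    have "(e \<oplus>\<^bsub>K\<^esub> f) \<otimes>\<^bsub>K\<^esub> x = f \<otimes>\<^bsub>K\<^esub> x"
      using that ef(1,2) z[OF ef(1) that] by (simp add: l_distr subI subJ)
    then show ?thesis using that by (simp add: subJ flip: ef(3))
  qed
  have "identity_of K I e"
    using e ef(1) comm[OF subI subI] by (simp add: identity_of_def)
  moreover have "identity_of K J f"
    using f ef(2) comm[OF subJ subJ] by (simp add: identity_of_def)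
  ultimately show "\<exists>!e. identity_of K I e" "\<exists>!e. identity_of K J e"
    by (auto intro: identity_of_unique)
qed

end

theory Submission
  imports Defs
begin

(* Let a and b in K correspond to ([1], [0]) and ([0], [1]).  Then ab = 0 and ann a meets ann b
   only in 0, so a + b is not a zero divisor, hence a unit since K is finite; therefore K is the
   direct product of ann b and ann a.  Associatedness in an ideal with identity agrees with
   associatedness in K, so the Theta graph of ann b is the subgraph of Theta K induced on the
   neighbours of [b], which corresponds to the neighbours of ([0], [1]), a copy of Theta L1. *)

section \<open>The vertices [0] and [1] of the graph\<close>

lemma assoc_class_zero:
  assumes "cring K"
  shows "assoc_class K \<zero>\<^bsub>K\<^esub> = {\<zero>\<^bsub>K\<^esub>}"
proof -
  interpret cring K by fact
  show ?thesis
    using Units_one_closed by (force simp: assoc_class_def unit_associated_def Units_closed)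
qed

text \<open>Only zero is annihilated by one, and the class of zero is a singleton. With
  \<open>Theta_adj_zero\<close> this drives all later coordinate arguments: a coordinate [1] forces
  the coordinate of each neighbour to be [0], while a coordinate [0] imposes no condition.\<close>

lemma Theta_adj_one:
  assumes "cring K" "V \<in> verts (Theta K)"
  shows "adj (Theta K) V (assoc_class K \<one>\<^bsub>K\<^esub>) \<longleftrightarrow> V = assoc_class K \<zero>\<^bsub>K\<^esub>"
proof -
  interpret cring K by fact
  obtain u where u: "u \<in> carrier K" "V = assoc_class K u"
    using assms(2) by (auto simp: Theta_def)
  have "V = assoc_class K \<zero>\<^bsub>K\<^esub> \<longleftrightarrow> u = \<zero>\<^bsub>K\<^esub>"
    using u assoc_class_self[OF assms(1) u(1)] assoc_class_zero[OF assms(1)] by auto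
  then show ?thesis
    using u Theta_adj_iff[OF assms(1) u(1) one_closed] by simp
qed

lemma Theta_adj_zero:
  assumes "cring K" "V \<in> verts (Theta K)"
  shows "adj (Theta K) V (assoc_class K \<zero>\<^bsub>K\<^esub>)" "adj (Theta K) (assoc_class K \<zero>\<^bsub>K\<^esub>) V"
proof -
  interpret cring K by fact
  obtain u where u: "u \<in> carrier K" "V = assoc_class K u"
    using assms(2) by (auto simp: Theta_def)
  show "adj (Theta K) V (assoc_class K \<zero>\<^bsub>K\<^esub>)" "adj (Theta K) (assoc_class K \<zero>\<^bsub>K\<^esub>) V"
    using u Theta_adj_iff[OF assms(1)] by simp_all
qed

section \<open>Associatedness inside an ideal with identity\<close>

text \<open>Units of the two rings correspond without changing their action on \<open>I\<close>. The
  complementary idempotent \<open>f\<close> = 1 - \<open>e\<close> kills \<open>I\<close>, so a unit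
  \<open>u\<close> of \<open>I\<close> extends to the unit \<open>u\<close> + \<open>f\<close> of
  \<open>K\<close>; conversely a unit \<open>u\<close> of \<open>K\<close> restricts to
  \<open>e\<close> times \<open>u\<close>.\<close>

lemma assoc_class_ideal_as_ring:
  assumes "cring K" "ideal I K" "identity_of K I e" "x \<in> I"
  shows "assoc_class (ideal_as_ring K I e) x = assoc_class K x"
proof -
  interpret cring K by fact
  interpret I: ideal I K by fact
  have sub: "\<And>y. y \<in> I \<Longrightarrow> y \<in> carrier K" using I.a_subset by auto
  have e: "e \<in> I" "\<And>y. y \<in> I \<Longrightarrow> e \<otimes>\<^bsub>K\<^esub> y = y" "\<And>y. y \<in> I \<Longrightarrow> y \<otimes>\<^bsub>K\<^esub> e = y"
    using assms(3) by (auto simp: identity_of_def)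
  have eK: "e \<in> carrier K" using e(1) sub by blast
  have xK: "x \<in> carrier K" using assms(4) sub by blast
  define f where "f = \<one>\<^bsub>K\<^esub> \<ominus>\<^bsub>K\<^esub> e"
  have fK: "f \<in> carrier K" unfolding f_def using eK by simp
  have If: "y \<otimes>\<^bsub>K\<^esub> f = \<zero>\<^bsub>K\<^esub>" if "y \<in> I" for y
    using that e(3)[OF that] sub[OF that] eK
    by (simp add: f_def minus_eq r_distr r_minus r_neg)
  have ef: "e \<oplus>\<^bsub>K\<^esub> f = \<one>\<^bsub>K\<^esub>"
    using eK by (simp add: f_def minus_eq a_lcomm[of e] r_neg)
  \<comment> \<open>Multiply \<open>e\<close> + \<open>f\<close> = 1 by \<open>f\<close> and use
    \<open>e\<close> times \<open>f\<close> = 0.\<close>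
  have ff: "f \<otimes>\<^bsub>K\<^esub> f = f"
  proof -
    have "(e \<oplus>\<^bsub>K\<^esub> f) \<otimes>\<^bsub>K\<^esub> f = f" using ef fK by simp
    then show ?thesis using If[OF e(1)] eK fK by (simp add: l_distr)
  qed
  have "unit_associated (ideal_as_ring K I e) y x \<longleftrightarrow> unit_associated K y x" for y
  proof
    assume "unit_associated (ideal_as_ring K I e) y x"
    then obtain u v where u: "u \<in> I" "v \<in> I" "u \<otimes>\<^bsub>K\<^esub> v = e" "y = x \<otimes>\<^bsub>K\<^esub> u"
      by (auto simp: unit_associated_def ideal_as_ring_def Units_def m_comm)
    have uv: "u \<in> carrier K" "v \<in> carrier K" using u(1,2) sub by auto
    have fv: "f \<otimes>\<^bsub>K\<^esub> v = \<zero>\<^bsub>K\<^esub>" using If[OF u(2)] uv fK by (simp add: m_comm)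
    \<comment> \<open>The mixed terms vanish because \<open>f\<close> kills \<open>I\<close>; what
      is left is \<open>u\<close> \<open>v\<close> + \<open>f\<close> \<open>f\<close> =
      \<open>e\<close> + \<open>f\<close> = 1.\<close>
    have one: "(u \<oplus>\<^bsub>K\<^esub> f) \<otimes>\<^bsub>K\<^esub> (v \<oplus>\<^bsub>K\<^esub> f) = \<one>\<^bsub>K\<^esub>"
      using eK uv fK If[OF u(1)] fv ff u(3) ef by (simp add: l_distr r_distr)
    have "(v \<oplus>\<^bsub>K\<^esub> f) \<otimes>\<^bsub>K\<^esub> (u \<oplus>\<^bsub>K\<^esub> f) = \<one>\<^bsub>K\<^esub>"
      using one uv fK by (simp add: m_comm)
    with one have "u \<oplus>\<^bsub>K\<^esub> f \<in> Units K"
      using uv fK unfolding Units_def by blast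
    moreover have "y = x \<otimes>\<^bsub>K\<^esub> (u \<oplus>\<^bsub>K\<^esub> f)"
      using u(4) If[OF assms(4)] xK uv fK by (simp add: r_distr)
    ultimately show "unit_associated K y x" by (auto simp: unit_associated_def)
  next
    assume "unit_associated K y x"
    then obtain u where u: "u \<in> Units K" "y = x \<otimes>\<^bsub>K\<^esub> u"
      by (auto simp: unit_associated_def)
    define v where "v = inv\<^bsub>K\<^esub> u"
    have uv: "u \<in> carrier K" "v \<in> carrier K" "u \<otimes>\<^bsub>K\<^esub> v = \<one>\<^bsub>K\<^esub>"
      using u(1) by (auto simp: v_def)
    \<comment> \<open>As \<open>e\<close> is idempotent, multiplying both \<open>u\<close> and its
      inverse by \<open>e\<close> gives mutually inverse elements with respect to the identity
      \<open>e\<close>.\<close>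
    have mem: "e \<otimes>\<^bsub>K\<^esub> u \<in> I" "e \<otimes>\<^bsub>K\<^esub> v \<in> I"
      using e(1) uv by (auto intro: I.I_r_closed)
    have "(e \<otimes>\<^bsub>K\<^esub> u) \<otimes>\<^bsub>K\<^esub> (e \<otimes>\<^bsub>K\<^esub> v) = (e \<otimes>\<^bsub>K\<^esub> e) \<otimes>\<^bsub>K\<^esub> (u \<otimes>\<^bsub>K\<^esub> v)"
      using eK uv(1,2) by (simp add: m_ac)
    also have "\<dots> = e" using uv(3) eK e(2)[OF e(1)] by simp
    finally have prod: "(e \<otimes>\<^bsub>K\<^esub> u) \<otimes>\<^bsub>K\<^esub> (e \<otimes>\<^bsub>K\<^esub> v) = e" .
    then have "(e \<otimes>\<^bsub>K\<^esub> v) \<otimes>\<^bsub>K\<^esub> (e \<otimes>\<^bsub>K\<^esub> u) = e"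
      using eK uv(1,2) by (simp add: m_comm)
    with prod have "e \<otimes>\<^bsub>K\<^esub> u \<in> Units (ideal_as_ring K I e)"
      using mem unfolding Units_def ideal_as_ring_def by auto
    moreover have "y = x \<otimes>\<^bsub>K\<^esub> (e \<otimes>\<^bsub>K\<^esub> u)"
      using u(2) e(3)[OF assms(4)] xK eK uv(1) by (simp flip: m_assoc)
    ultimately show "unit_associated (ideal_as_ring K I e) y x"
      by (auto simp: unit_associated_def ideal_as_ring_def)
  qed
  \<comment> \<open>The class taken in \<open>K\<close> does not leave \<open>I\<close>, so
    replacing the carrier by \<open>I\<close> loses no element of it.\<close>
  moreover have "y \<in> I" if "unit_associated K y x" for y
    using that I.I_r_closed[OF assms(4)] by (auto simp: unit_associated_def)
  ultimately show ?thesis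
    using sub by (auto simp: assoc_class_def ideal_as_ring_def)
qed

section \<open>Annihilators and the direct decomposition\<close>

lemma ideal_annihilator:
  assumes "cring K" "b \<in> carrier K"
  shows "ideal {x \<in> carrier K. x \<otimes>\<^bsub>K\<^esub> b = \<zero>\<^bsub>K\<^esub>} K"
proof -
  interpret cring K by fact
  show ?thesis
  proof (rule idealI[OF ring_axioms])
    show "subgroup {x \<in> carrier K. x \<otimes>\<^bsub>K\<^esub> b = \<zero>\<^bsub>K\<^esub>} (add_monoid K)"
    proof (rule add.subgroupI)
      fix x assume x: "x \<in> {x \<in> carrier K. x \<otimes>\<^bsub>K\<^esub> b = \<zero>\<^bsub>K\<^esub>}"
      then show "\<ominus>\<^bsub>K\<^esub> x \<in> {x \<in> carrier K. x \<otimes>\<^bsub>K\<^esub> b = \<zero>\<^bsub>K\<^esub>}"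
        using assms(2) by (simp add: l_minus)
      fix y assume "y \<in> {x \<in> carrier K. x \<otimes>\<^bsub>K\<^esub> b = \<zero>\<^bsub>K\<^esub>}"
      with x show "x \<oplus>\<^bsub>K\<^esub> y \<in> {x \<in> carrier K. x \<otimes>\<^bsub>K\<^esub> b = \<zero>\<^bsub>K\<^esub>}"
        using assms(2) by (simp add: l_distr)
    qed (use assms(2) l_null zero_closed in blast)+
  next
    fix x y assume x: "x \<in> {x \<in> carrier K. x \<otimes>\<^bsub>K\<^esub> b = \<zero>\<^bsub>K\<^esub>}" and y: "y \<in> carrier K"
    then have "y \<otimes>\<^bsub>K\<^esub> x \<otimes>\<^bsub>K\<^esub> b = \<zero>\<^bsub>K\<^esub>" using assms(2) by (simp add: m_assoc)
    then show "y \<otimes>\<^bsub>K\<^esub> x \<in> {x \<in> carrier K. x \<otimes>\<^bsub>K\<^esub> b = \<zero>\<^bsub>K\<^esub>}"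
      and "x \<otimes>\<^bsub>K\<^esub> y \<in> {x \<in> carrier K. x \<otimes>\<^bsub>K\<^esub> b = \<zero>\<^bsub>K\<^esub>}"
      using x y by (simp_all add: m_comm)
  qed
qed

text \<open>Multiplication by \<open>a\<close> + \<open>b\<close> is injective, hence surjective on
  a finite carrier. If \<open>c\<close> is the inverse of \<open>a\<close> + \<open>b\<close>, then
  1 = \<open>a\<close> \<open>c\<close> + \<open>b\<close> \<open>c\<close> splits one between the
  two annihilators, and every element is split by multiplying this equation by it.\<close>

lemma internal_direct_product_annihilators:
  assumes "cring K" "finite (carrier K)" and a: "a \<in> carrier K" and b: "b \<in> carrier K"
    and ab: "a \<otimes>\<^bsub>K\<^esub> b = \<zero>\<^bsub>K\<^esub>"
    and ann: "\<And>x. \<lbrakk>x \<in> carrier K; x \<otimes>\<^bsub>K\<^esub> a = \<zero>\<^bsub>K\<^esub>; x \<otimes>\<^bsub>K\<^esub> b = \<zero>\<^bsub>K\<^esub>\<rbrakk> \<Longrightarrow> x = \<zero>\<^bsub>K\<^esub>"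
  shows "internal_direct_product K {x \<in> carrier K. x \<otimes>\<^bsub>K\<^esub> b = \<zero>\<^bsub>K\<^esub>}
           {x \<in> carrier K. x \<otimes>\<^bsub>K\<^esub> a = \<zero>\<^bsub>K\<^esub>}" (is "internal_direct_product K ?I ?J")
proof -
  interpret cring K by fact
  have I: "ideal ?I K" using ideal_annihilator[OF assms(1) b] .
  have J: "ideal ?J K" using ideal_annihilator[OF assms(1) a] .
  have ba: "b \<otimes>\<^bsub>K\<^esub> a = \<zero>\<^bsub>K\<^esub>" using ab a b by (simp add: m_comm)
  \<comment> \<open>The assumption \<open>ann\<close> is applied twice: first to \<open>a\<close>
    \<open>x\<close>, which is killed by both \<open>a\<close> and \<open>b\<close>, and then, once
    \<open>a\<close> \<open>x\<close> = \<open>b\<close> \<open>x\<close> = 0 is known, to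
    \<open>x\<close> itself.\<close>
  have regular: "x = \<zero>\<^bsub>K\<^esub>" if x: "x \<in> carrier K" and z: "(a \<oplus>\<^bsub>K\<^esub> b) \<otimes>\<^bsub>K\<^esub> x = \<zero>\<^bsub>K\<^esub>" for x
  proof -
    have zero: "a \<otimes>\<^bsub>K\<^esub> x \<oplus>\<^bsub>K\<^esub> b \<otimes>\<^bsub>K\<^esub> x = \<zero>\<^bsub>K\<^esub>" using z x a b by (simp add: l_distr)
    have axb: "(a \<otimes>\<^bsub>K\<^esub> x) \<otimes>\<^bsub>K\<^esub> b = \<zero>\<^bsub>K\<^esub>"
    proof -
      have "(a \<otimes>\<^bsub>K\<^esub> x) \<otimes>\<^bsub>K\<^esub> b = (a \<otimes>\<^bsub>K\<^esub> b) \<otimes>\<^bsub>K\<^esub> x" using a b x by (simp add: m_ac)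
      then show ?thesis using ab x by simp
    qed
    have bxa: "(b \<otimes>\<^bsub>K\<^esub> x) \<otimes>\<^bsub>K\<^esub> a = \<zero>\<^bsub>K\<^esub>"
    proof -
      have "(b \<otimes>\<^bsub>K\<^esub> x) \<otimes>\<^bsub>K\<^esub> a = (a \<otimes>\<^bsub>K\<^esub> b) \<otimes>\<^bsub>K\<^esub> x" using a b x by (simp add: m_ac)
      then show ?thesis using ab x by simp
    qed
    \<comment> \<open>Multiplying the vanishing sum by \<open>a\<close> removes its second summand,
      since \<open>a\<close> \<open>b\<close> = 0.\<close>
    have "(a \<otimes>\<^bsub>K\<^esub> x \<oplus>\<^bsub>K\<^esub> b \<otimes>\<^bsub>K\<^esub> x) \<otimes>\<^bsub>K\<^esub> a = (a \<otimes>\<^bsub>K\<^esub> x) \<otimes>\<^bsub>K\<^esub> a"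
      using a b x by (simp add: l_distr bxa)
    then have axa: "(a \<otimes>\<^bsub>K\<^esub> x) \<otimes>\<^bsub>K\<^esub> a = \<zero>\<^bsub>K\<^esub>" unfolding zero using a by simp
    have ax: "a \<otimes>\<^bsub>K\<^esub> x = \<zero>\<^bsub>K\<^esub>" by (rule ann) (use axa axb a x in auto)
    with zero have "b \<otimes>\<^bsub>K\<^esub> x = \<zero>\<^bsub>K\<^esub>" using b x by simp
    then show ?thesis using ann[OF x] ax a b x by (simp add: m_comm)
  qed
  have "inj_on ((\<otimes>\<^bsub>K\<^esub>) (a \<oplus>\<^bsub>K\<^esub> b)) (carrier K)"
  proof (rule inj_onI)
    fix x y assume xy: "x \<in> carrier K" "y \<in> carrier K"
      and eq: "(a \<oplus>\<^bsub>K\<^esub> b) \<otimes>\<^bsub>K\<^esub> x = (a \<oplus>\<^bsub>K\<^esub> b) \<otimes>\<^bsub>K\<^esub> y"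
    have "(a \<oplus>\<^bsub>K\<^esub> b) \<otimes>\<^bsub>K\<^esub> (x \<ominus>\<^bsub>K\<^esub> y) = (a \<oplus>\<^bsub>K\<^esub> b) \<otimes>\<^bsub>K\<^esub> x \<ominus>\<^bsub>K\<^esub> (a \<oplus>\<^bsub>K\<^esub> b) \<otimes>\<^bsub>K\<^esub> y"
      using xy a b by (simp add: minus_eq r_distr r_minus)
    also have "\<dots> = \<zero>\<^bsub>K\<^esub>" using eq xy a b by (simp add: minus_eq r_neg)
    finally have "x \<ominus>\<^bsub>K\<^esub> y = \<zero>\<^bsub>K\<^esub>" using regular xy by simp
    then show "x = y" using xy by simp
  qed
  \<comment> \<open>Finiteness enters here: an injective self-map of a finite set is onto, so one is
    attained.\<close>
  then have "(\<otimes>\<^bsub>K\<^esub>) (a \<oplus>\<^bsub>K\<^esub> b) ` carrier K = carrier K"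
    using assms(2) a b by (intro endo_inj_surj) auto
  then obtain c where c: "c \<in> carrier K" "(a \<oplus>\<^bsub>K\<^esub> b) \<otimes>\<^bsub>K\<^esub> c = \<one>\<^bsub>K\<^esub>"
    using one_closed by (metis imageE)
  have "a \<in> ?I" "b \<in> ?J" using a b ab ba by auto
  then have mem: "a \<otimes>\<^bsub>K\<^esub> c \<in> ?I" "b \<otimes>\<^bsub>K\<^esub> c \<in> ?J"
    using c(1) ideal.I_r_closed[OF I] ideal.I_r_closed[OF J] by blast+
  have sum: "a \<otimes>\<^bsub>K\<^esub> c \<oplus>\<^bsub>K\<^esub> b \<otimes>\<^bsub>K\<^esub> c = \<one>\<^bsub>K\<^esub>" using c a b by (simp add: l_distr)
  have "x \<in> ?I <+>\<^bsub>K\<^esub> ?J" if x: "x \<in> carrier K" for x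
  proof -
    have "x = (a \<otimes>\<^bsub>K\<^esub> c) \<otimes>\<^bsub>K\<^esub> x \<oplus>\<^bsub>K\<^esub> (b \<otimes>\<^bsub>K\<^esub> c) \<otimes>\<^bsub>K\<^esub> x"
      using sum x a b c(1) by (simp flip: l_distr)
    moreover have "(a \<otimes>\<^bsub>K\<^esub> c) \<otimes>\<^bsub>K\<^esub> x \<in> ?I" "(b \<otimes>\<^bsub>K\<^esub> c) \<otimes>\<^bsub>K\<^esub> x \<in> ?J"
      using mem x ideal.I_r_closed[OF I] ideal.I_r_closed[OF J] by blast+
    ultimately show ?thesis unfolding set_add_def' by blast
  qed
  moreover have "?I <+>\<^bsub>K\<^esub> ?J \<subseteq> carrier K" by (auto simp: set_add_def')
  moreover have "?I \<inter> ?J = {\<zero>\<^bsub>K\<^esub>}" using ann a b by auto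
  ultimately show ?thesis
    unfolding internal_direct_product_def using I J by blast
qed

section \<open>The graph of an annihilator as one tensor factor\<close>

text \<open>The classes of elements of \<open>I\<close> are exactly those that \<open>f\<close>
  sends to pairs with second coordinate [0], and on this slice the first coordinate is the required
  isomorphism. One factor suffices, as the other follows by exchanging \<open>L1\<close> and
  \<open>L2\<close>.\<close>

lemma Theta_annihilator_iso:
  assumes K: "cring K" and L1: "cring L1" and L2: "cring L2"
    and f: "bij_betw f (verts (Theta K)) (verts (Theta L1) \<times> verts (Theta L2))"
    and adj: "\<And>x y. \<lbrakk>x \<in> verts (Theta K); y \<in> verts (Theta K)\<rbrakk> \<Longrightarrow>
      adj (Theta K) x y \<longleftrightarrow>
        adj (Theta L1) (fst (f x)) (fst (f y)) \<and> adj (Theta L2) (snd (f x)) (snd (f y))"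
    and b: "b \<in> carrier K" "f (assoc_class K b) = (assoc_class L1 \<zero>\<^bsub>L1\<^esub>, assoc_class L2 \<one>\<^bsub>L2\<^esub>)"
    and I: "I = {x \<in> carrier K. x \<otimes>\<^bsub>K\<^esub> b = \<zero>\<^bsub>K\<^esub>}" and e: "identity_of K I e"
  shows "graph_iso (Theta (ideal_as_ring K I e)) (Theta L1)"
proof -
  interpret K: cring K by fact
  interpret L1: cring L1 by fact
  interpret L2: cring L2 by fact
  have ideal: "ideal I K" using ideal_annihilator[OF K b(1)] I by simp
  have subI: "x \<in> carrier K" if "x \<in> I" for x using that I by simp
  have classI: "assoc_class (ideal_as_ring K I e) x = assoc_class K x" if "x \<in> I" for x
    using assoc_class_ideal_as_ring[OF K ideal e that] .
  have vertsI: "verts (Theta (ideal_as_ring K I e)) = assoc_class K ` I"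
    using classI by (auto simp: Theta_def ideal_as_ring_def)
  \<comment> \<open>Both sides say that the product of \<open>x\<close> and \<open>y\<close> is
    zero, and the ideal inherits multiplication and zero from \<open>K\<close>.\<close>
  have adjI: "adj (Theta (ideal_as_ring K I e)) (assoc_class K x) (assoc_class K y) \<longleftrightarrow>
      adj (Theta K) (assoc_class K x) (assoc_class K y)" if "x \<in> I" "y \<in> I" for x y
    using Theta_adj_iff[OF ideal_as_ring_cring[OF K ideal e], of x y] that classI
      Theta_adj_iff[OF K subI subI, of x y]
    by (simp add: ideal_as_ring_def)
  have vertK: "assoc_class K x \<in> verts (Theta K)" if "x \<in> carrier K" for x
    using that by (auto simp: Theta_def)
  have fV: "fst (f V) \<in> verts (Theta L1)" "snd (f V) \<in> verts (Theta L2)"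
    if "V \<in> verts (Theta K)" for V
    using bij_betwE[OF f] that by (auto simp: mem_Times_iff)
  \<comment> \<open>Membership in \<open>I\<close> is adjacency to the class of \<open>b\<close>.
    Its first coordinate [0] leaves the first coordinate of \<open>x\<close> free; its second
    coordinate [1] forces that of \<open>x\<close> to be [0].\<close>
  have memI: "x \<in> I \<longleftrightarrow> snd (f (assoc_class K x)) = assoc_class L2 \<zero>\<^bsub>L2\<^esub>"
    if x: "x \<in> carrier K" for x
  proof -
    note V = fV[OF vertK[OF x]]
    have "x \<in> I \<longleftrightarrow> adj (Theta K) (assoc_class K x) (assoc_class K b)"
      using x I Theta_adj_iff[OF K x b(1)] by simp
    also have "\<dots> \<longleftrightarrow> adj (Theta L2) (snd (f (assoc_class K x))) (assoc_class L2 \<one>\<^bsub>L2\<^esub>)"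
      using adj[OF vertK[OF x] vertK[OF b(1)]] b(2) Theta_adj_zero(1)[OF L1 V(1)] by simp
    finally show ?thesis using Theta_adj_one[OF L2 V(2)] by simp
  qed
  have sndI: "snd (f V) = assoc_class L2 \<zero>\<^bsub>L2\<^esub>" if "V \<in> assoc_class K ` I" for V
    using that memI subI by blast
  have "bij_betw (\<lambda>V. fst (f V)) (assoc_class K ` I) (verts (Theta L1))"
  proof (rule bij_betw_imageI)
    show "inj_on (\<lambda>V. fst (f V)) (assoc_class K ` I)"
    proof (rule inj_onI)
      fix V W assume V: "V \<in> assoc_class K ` I" and W: "W \<in> assoc_class K ` I"
        and fst: "fst (f V) = fst (f W)"
      have "f V = f W" using fst sndI[OF V] sndI[OF W] by (simp add: prod_eqI)
      moreover have "V \<in> verts (Theta K)" "W \<in> verts (Theta K)"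
        using V W vertK subI by auto
      ultimately show "V = W" using f by (auto simp: bij_betw_def dest: inj_onD)
    qed
    show "(\<lambda>V. fst (f V)) ` assoc_class K ` I = verts (Theta L1)"
    proof
      show "(\<lambda>V. fst (f V)) ` assoc_class K ` I \<subseteq> verts (Theta L1)"
        using fV vertK subI by auto
      show "verts (Theta L1) \<subseteq> (\<lambda>V. fst (f V)) ` assoc_class K ` I"
      proof
        fix W assume W: "W \<in> verts (Theta L1)"
        \<comment> \<open>The preimage of \<open>W\<close> is sought over the pair
          (\<open>W\<close>, [0]), which \<open>memI\<close> places in the slice.\<close>
        have "assoc_class L2 \<zero>\<^bsub>L2\<^esub> \<in> verts (Theta L2)" by (auto simp: Theta_def)
        then have "(W, assoc_class L2 \<zero>\<^bsub>L2\<^esub>) \<in> f ` verts (Theta K)"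
          using W bij_betw_imp_surj_on[OF f] by simp
        then obtain x where x: "x \<in> carrier K"
          "f (assoc_class K x) = (W, assoc_class L2 \<zero>\<^bsub>L2\<^esub>)"
          by (auto simp: Theta_def)
        then have "x \<in> I" using memI by simp
        then show "W \<in> (\<lambda>V. fst (f V)) ` assoc_class K ` I"
          using x(2) by (force intro: image_eqI[of _ _ "assoc_class K x"])
      qed
    qed
  qed
  \<comment> \<open>Both second coordinates are [0], and [0] carries a loop, so adjacency is decided
    by the first coordinates alone.\<close>
  moreover have "adj (Theta (ideal_as_ring K I e)) V W \<longleftrightarrow> adj (Theta L1) (fst (f V)) (fst (f W))"
    if VW: "V \<in> assoc_class K ` I" "W \<in> assoc_class K ` I" for V W
  proof -
    obtain x y where xy: "x \<in> I" "y \<in> I" "V = assoc_class K x" "W = assoc_class K y"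
      using VW by auto
    show ?thesis
      using sndI[OF VW(1)] sndI[OF VW(2)] adjI[OF xy(1,2)] adj[OF vertK[OF subI[OF xy(1)]] vertK[OF subI[OF xy(2)]]]
        xy(3,4) Theta_adj_iff[OF L2 L2.zero_closed L2.zero_closed] by simp
  qed
  ultimately show ?thesis unfolding graph_iso_def vertsI by blast
qed

section \<open>Recovering the decomposition from the graph isomorphism\<close>

theorem theorem3p6:
  fixes K :: "('a, 'm) ring_scheme" and L1 :: "('b, 'n) ring_scheme" and L2 :: "('c, 'p) ring_scheme"
  assumes "cring K" "finite (carrier K)"
    and "cring L1" "finite (carrier L1)"
    and "cring L2" "finite (carrier L2)"
    and "graph_iso (Theta K) (tensor_product (Theta L1) (Theta L2))"
  shows "\<exists>K1 K2 e1 e2.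
           internal_direct_product K K1 K2 \<and>
           identity_of K K1 e1 \<and> identity_of K K2 e2 \<and>
           graph_iso (Theta (ideal_as_ring K K1 e1)) (Theta L1) \<and>
           graph_iso (Theta (ideal_as_ring K K2 e2)) (Theta L2)"
proof -
  note K = assms(1) and L1 = assms(3) and L2 = assms(5)
  interpret K: cring K by fact
  interpret L1: cring L1 by fact
  interpret L2: cring L2 by fact
  obtain f where f: "bij_betw f (verts (Theta K)) (verts (Theta L1) \<times> verts (Theta L2))"
    and adj: "\<And>x y. \<lbrakk>x \<in> verts (Theta K); y \<in> verts (Theta K)\<rbrakk> \<Longrightarrow>
      adj (Theta K) x y \<longleftrightarrow>
        adj (Theta L1) (fst (f x)) (fst (f y)) \<and> adj (Theta L2) (snd (f x)) (snd (f y))"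
    using assms(7) by (auto simp: graph_iso_def tensor_product_def)
  have vert1: "assoc_class L1 \<zero>\<^bsub>L1\<^esub> \<in> verts (Theta L1)" "assoc_class L1 \<one>\<^bsub>L1\<^esub> \<in> verts (Theta L1)"
    by (auto simp: Theta_def)
  have vert2: "assoc_class L2 \<zero>\<^bsub>L2\<^esub> \<in> verts (Theta L2)" "assoc_class L2 \<one>\<^bsub>L2\<^esub> \<in> verts (Theta L2)"
    by (auto simp: Theta_def)
  have vertK: "assoc_class K x \<in> verts (Theta K)" if "x \<in> carrier K" for x
    using that by (auto simp: Theta_def)
  have fV: "fst (f V) \<in> verts (Theta L1)" "snd (f V) \<in> verts (Theta L2)"
    if "V \<in> verts (Theta K)" for V
    using bij_betwE[OF f] that by (auto simp: mem_Times_iff)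
  have preimage: "\<exists>x\<in>carrier K. f (assoc_class K x) = (U, V)"
    if "U \<in> verts (Theta L1)" "V \<in> verts (Theta L2)" for U V
  proof -
    have "(U, V) \<in> f ` verts (Theta K)" using that bij_betw_imp_surj_on[OF f] by simp
    then show ?thesis by (auto simp: Theta_def)
  qed
  obtain a where a: "a \<in> carrier K"
    "f (assoc_class K a) = (assoc_class L1 \<one>\<^bsub>L1\<^esub>, assoc_class L2 \<zero>\<^bsub>L2\<^esub>)"
    using preimage[OF vert1(2) vert2(1)] by blast
  obtain b where b: "b \<in> carrier K"
    "f (assoc_class K b) = (assoc_class L1 \<zero>\<^bsub>L1\<^esub>, assoc_class L2 \<one>\<^bsub>L2\<^esub>)"
    using preimage[OF vert1(1) vert2(2)] by blast
  have mult_zero: "x \<otimes>\<^bsub>K\<^esub> y = \<zero>\<^bsub>K\<^esub> \<longleftrightarrow>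
      adj (Theta L1) (fst (f (assoc_class K x))) (fst (f (assoc_class K y))) \<and>
      adj (Theta L2) (snd (f (assoc_class K x))) (snd (f (assoc_class K y)))"
    if "x \<in> carrier K" "y \<in> carrier K" for x y
    using Theta_adj_iff[OF K that] adj[OF vertK vertK] that by blast
  \<comment> \<open>In each coordinate one of the two classes is [0].\<close>
  have ab: "a \<otimes>\<^bsub>K\<^esub> b = \<zero>\<^bsub>K\<^esub>"
    using mult_zero[OF a(1) b(1)] a(2) b(2) Theta_adj_zero(1)[OF L1 vert1(2)]
      Theta_adj_zero(2)[OF L2 vert2(2)] by simp
  have ann: "x = \<zero>\<^bsub>K\<^esub>"
    if x: "x \<in> carrier K" and xa: "x \<otimes>\<^bsub>K\<^esub> a = \<zero>\<^bsub>K\<^esub>" and xb: "x \<otimes>\<^bsub>K\<^esub> b = \<zero>\<^bsub>K\<^esub>" for x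
  proof -
    note V = fV[OF vertK[OF x]]
    have "fst (f (assoc_class K x)) = assoc_class L1 \<zero>\<^bsub>L1\<^esub>"
      using mult_zero[OF x a(1)] xa a(2) Theta_adj_one[OF L1 V(1)] by simp
    moreover have "snd (f (assoc_class K x)) = assoc_class L2 \<zero>\<^bsub>L2\<^esub>"
      using mult_zero[OF x b(1)] xb b(2) Theta_adj_one[OF L2 V(2)] by simp
    \<comment> \<open>The class of \<open>x\<close> lies over ([0], [0]), which is adjacent to every
      vertex. Testing it against the class of one yields \<open>x\<close> = 0 without knowing where
      \<open>f\<close> sends the class of zero.\<close>
    ultimately have "x \<otimes>\<^bsub>K\<^esub> \<one>\<^bsub>K\<^esub> = \<zero>\<^bsub>K\<^esub>"
      using mult_zero[OF x K.one_closed] fV[OF vertK[OF K.one_closed]]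
        Theta_adj_zero(2)[OF L1] Theta_adj_zero(2)[OF L2] by simp
    then show ?thesis using x by simp
  qed
  define K1 where "K1 = {x \<in> carrier K. x \<otimes>\<^bsub>K\<^esub> b = \<zero>\<^bsub>K\<^esub>}"
  define K2 where "K2 = {x \<in> carrier K. x \<otimes>\<^bsub>K\<^esub> a = \<zero>\<^bsub>K\<^esub>}"
  have prod: "internal_direct_product K K1 K2"
    unfolding K1_def K2_def
    using internal_direct_product_annihilators[OF K assms(2) a(1) b(1) ab ann] .
  then obtain e1 e2 where e: "identity_of K K1 e1" "identity_of K K2 e2"
    using internal_direct_product_identities[OF K] by blast
  have "graph_iso (Theta (ideal_as_ring K K1 e1)) (Theta L1)"
    by (rule Theta_annihilator_iso[OF K L1 L2 f adj b K1_def e(1)])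
  moreover have "graph_iso (Theta (ideal_as_ring K K2 e2)) (Theta L2)"
  \<comment> \<open>Swapping coordinates turns the image ([1], [0]) of the class of \<open>a\<close>
    into ([0], [1]), so \<open>a\<close> takes the role of \<open>b\<close> with the two factors
    exchanged.\<close>
  proof (rule Theta_annihilator_iso[OF K L2 L1 _ _ a(1) _ K2_def e(2), of "prod.swap \<circ> f"])
    show "bij_betw (prod.swap \<circ> f) (verts (Theta K)) (verts (Theta L2) \<times> verts (Theta L1))"
      by (rule bij_betw_trans[OF f]) (auto simp: bij_betw_def product_swap)
  qed (use adj a(2) in auto)
  ultimately show ?thesis using prod e by blast
qed

end
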